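(* Let $\alpha,\beta,\gamma,\delta\in\mathbb{R}$ with $\alpha+\delta\neq0$ and $\alpha\gamma-\beta\delta=0$, and let $(G_6,g,J)$ be the connected, simply connected three-dimensional Lie group with left-invariant Lorentzian metric $g$ whose Lie algebra $\mathfrak{g}$ has a pseudo-orthonormal basis $\{e_1,e_2,e_3\}$ with $e_3$ timelike such that $$[e_1,e_2]=\alpha e_2+\beta e_3,\quad [e_1,e_3]=\gamma e_2+\delta e_3,\quad [e_2,e_3]=0,$$ equipped with the product structure $Je_1=e_1$, $Je_2=e_2$, $Je_3=-e_3$. Let $c\in\mathbb{R}$. Then $(G_6,g,J)$ is a first kind algebraic Wanas soliton associated to the canonical connection $\nabla^0$ with constant $c$ (i.e. $\mathrm{Wan}^0=c\,\mathrm{Id}+D$ with $D$ a derivation of $\mathfrak g$) if and only if one of the following holds: (i) $\alpha\neq0$, $\beta=\gamma=\delta=0$, $\alpha^2+c=0$; in particular $De_1=0$, $De_2=0$, $De_3=\alpha^2e_3$. (ii) $\beta=\gamma=0$, $\alpha^2+\delta^2+c=0$, $\delta\neq0$, $\alpha+\delta\neq0$; in particular $De_1=0$, $De_2=\delta^2e_2$, $De_3=(\alpha^2+\delta^2)e_3$. (iii) $\beta\neq0$, $\delta\neq0$, $\gamma=-\beta$, $\delta=-\alpha$, $\alpha^2=\beta^2$, $\alpha^2+c=0$; in particular $De_1=0$, $De_2=-\beta^2e_2-\alpha\beta e_3$, $De_3=\alpha\beta e_2+\alpha^2e_3$.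
   Context: Pseudo-orthonormal with $e_3$ timelike means $g(e_1,e_1)=g(e_2,e_2)=1$, $g(e_3,e_3)=-1$, $g(e_i,e_j)=0$ for $i\ne j$. All tensors are left-invariant and evaluated on the Lie algebra $\mathfrak{g}$ of left-invariant vector fields. Let $\nabla$ be the Levi-Civita connection of $g$, and let $J$ be the product structure given in the claim, with $(\nabla_XJ)Y=\nabla_X(JY)-J(\nabla_XY)$. Canonical connection: $\nabla^0_XY=\nabla_XY-\frac12(\nabla_XJ)JY$. Curvature: $R^0(X,Y)Z=\nabla^0_X\nabla^0_YZ-\nabla^0_Y\nabla^0_XZ-\nabla^0_{[X,Y]}Z$. Torsion: $T^0(X,Y)=\nabla^0_XY-\nabla^0_YX-[X,Y]$. $A^0(X,Y)Z=T^0(T^0(X,Y),Z)$, and the Wanas tensor is $W^0(X,Y)Z=R^0(X,Y)Z-A^0(X,Y)Z$. $w^0(X,Y)=-g(W^0(X,e_1)Y,e_1)-g(W^0(X,e_2)Y,e_2)+g(W^0(X,e_3)Y,e_3)$. The operator $\mathrm{Wan}^0:\mathfrak g\to\mathfrak g$ is defined by $w^0(X,Y)=g(\mathrm{Wan}^0(X),Y)$. A derivation of $\mathfrak g$ is a linear map $D$ with $D[X,Y]=[DX,Y]+[X,DY]$ for all $X,Y\in\mathfrak g$. $(G_6,g,J)$ is a first kind algebraic Wanas soliton associated to $\nabla^0$ (with constant $c$) if $\mathrm{Wan}^0=c\,\mathrm{Id}+D$ for the real number $c$ and a derivation $D$ of $\mathfrak g$. *)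

theory Defs
  imports "HOL-Analysis.Analysis"
begin

text \<open>
  The type \<open>'a\<close> plays the role of the Lie algebra of left-invariant vector fields of a Lie group.
  All tensors are left-invariant, so they are represented by multilinear maps on \<open>'a\<close>.
\<close>

definition lie_bracket :: "('a::real_vector \<Rightarrow> 'a \<Rightarrow> 'a) \<Rightarrow> bool" where
  "lie_bracket br \<longleftrightarrow> bilinear br \<and> (\<forall>X. br X X = 0) \<and>
     (\<forall>X Y Z. br X (br Y Z) + br Y (br Z X) + br Z (br X Y) = 0)"

definition lie_derivation :: "('a::real_vector \<Rightarrow> 'a \<Rightarrow> 'a) \<Rightarrow> ('a \<Rightarrow> 'a) \<Rightarrow> bool" where
  "lie_derivation br D \<longleftrightarrow> linear D \<and> (\<forall>X Y. D (br X Y) = br (D X) Y + br X (D Y))"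

definition pseudo_orthonormal_basis ::
    "('a::real_vector \<Rightarrow> 'a \<Rightarrow> real) \<Rightarrow> 'a \<Rightarrow> 'a \<Rightarrow> 'a \<Rightarrow> bool" where
  "pseudo_orthonormal_basis g e1 e2 e3 \<longleftrightarrow>
     distinct [e1, e2, e3] \<and> independent {e1, e2, e3} \<and> span {e1, e2, e3} = UNIV \<and>
     g e1 e1 = 1 \<and> g e2 e2 = 1 \<and> g e3 e3 = - 1 \<and>
     g e1 e2 = 0 \<and> g e2 e1 = 0 \<and> g e1 e3 = 0 \<and> g e3 e1 = 0 \<and> g e2 e3 = 0 \<and> g e3 e2 = 0"

text \<open>Three-dimensional Lorentzian metrics: the existence of the basis fixes the dimension and the signature.\<close>

definition lorentzian_metric3 :: "('a::real_vector \<Rightarrow> 'a \<Rightarrow> real) \<Rightarrow> bool" where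
  "lorentzian_metric3 g \<longleftrightarrow> bilinear g \<and> (\<forall>X Y. g X Y = g Y X) \<and>
     (\<exists>e1 e2 e3. pseudo_orthonormal_basis g e1 e2 e3)"

text \<open>
  For left-invariant fields the function \<open>g Y Z\<close> is constant on the group, so its derivative along \<open>X\<close>
  vanishes; hence the shape of the metric-compatibility condition below.
\<close>

definition is_levi_civita ::
    "('a::real_vector \<Rightarrow> 'a \<Rightarrow> 'a) \<Rightarrow> ('a \<Rightarrow> 'a \<Rightarrow> real) \<Rightarrow> ('a \<Rightarrow> 'a \<Rightarrow> 'a) \<Rightarrow> bool" where
  "is_levi_civita br g nabla \<longleftrightarrow> bilinear nabla \<and>
     (\<forall>X Y. nabla X Y - nabla Y X = br X Y) \<and>
     (\<forall>X Y Z. g (nabla X Y) Z + g Y (nabla X Z) = 0)"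

definition levi_civita ::
    "('a::real_vector \<Rightarrow> 'a \<Rightarrow> 'a) \<Rightarrow> ('a \<Rightarrow> 'a \<Rightarrow> real) \<Rightarrow> 'a \<Rightarrow> 'a \<Rightarrow> 'a" where
  "levi_civita br g = (THE nabla. is_levi_civita br g nabla)"

definition cov_deriv_endo ::
    "('a::real_vector \<Rightarrow> 'a \<Rightarrow> 'a) \<Rightarrow> ('a \<Rightarrow> 'a) \<Rightarrow> 'a \<Rightarrow> 'a \<Rightarrow> 'a" where
  "cov_deriv_endo nabla J X Y = nabla X (J Y) - J (nabla X Y)"

definition canonical_connection ::
    "('a::real_vector \<Rightarrow> 'a \<Rightarrow> 'a) \<Rightarrow> ('a \<Rightarrow> 'a \<Rightarrow> real) \<Rightarrow> ('a \<Rightarrow> 'a) \<Rightarrow> 'a \<Rightarrow> 'a \<Rightarrow> 'a" where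
  "canonical_connection br g J X Y =
     levi_civita br g X Y - (1/2) *\<^sub>R cov_deriv_endo (levi_civita br g) J X (J Y)"

definition curvature ::
    "('a::real_vector \<Rightarrow> 'a \<Rightarrow> 'a) \<Rightarrow> ('a \<Rightarrow> 'a \<Rightarrow> 'a) \<Rightarrow> 'a \<Rightarrow> 'a \<Rightarrow> 'a \<Rightarrow> 'a" where
  "curvature br nabla X Y Z =
     nabla X (nabla Y Z) - nabla Y (nabla X Z) - nabla (br X Y) Z"

definition torsion ::
    "('a::real_vector \<Rightarrow> 'a \<Rightarrow> 'a) \<Rightarrow> ('a \<Rightarrow> 'a \<Rightarrow> 'a) \<Rightarrow> 'a \<Rightarrow> 'a \<Rightarrow> 'a" where
  "torsion br nabla X Y = nabla X Y - nabla Y X - br X Y"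

definition wanas_tensor ::
    "('a::real_vector \<Rightarrow> 'a \<Rightarrow> 'a) \<Rightarrow> ('a \<Rightarrow> 'a \<Rightarrow> 'a) \<Rightarrow> 'a \<Rightarrow> 'a \<Rightarrow> 'a \<Rightarrow> 'a" where
  "wanas_tensor br nabla X Y Z =
     curvature br nabla X Y Z - torsion br nabla (torsion br nabla X Y) Z"

definition wanas_form ::
    "('a::real_vector \<Rightarrow> 'a \<Rightarrow> 'a) \<Rightarrow> ('a \<Rightarrow> 'a \<Rightarrow> real) \<Rightarrow> ('a \<Rightarrow> 'a \<Rightarrow> 'a) \<Rightarrow>
     'a \<Rightarrow> 'a \<Rightarrow> 'a \<Rightarrow> 'a \<Rightarrow> 'a \<Rightarrow> real" where
  "wanas_form br g nabla e1 e2 e3 X Y =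
     - g (wanas_tensor br nabla X e1 Y) e1
     - g (wanas_tensor br nabla X e2 Y) e2
     + g (wanas_tensor br nabla X e3 Y) e3"

definition wanas_operator ::
    "('a::real_vector \<Rightarrow> 'a \<Rightarrow> 'a) \<Rightarrow> ('a \<Rightarrow> 'a \<Rightarrow> real) \<Rightarrow> ('a \<Rightarrow> 'a \<Rightarrow> 'a) \<Rightarrow>
     'a \<Rightarrow> 'a \<Rightarrow> 'a \<Rightarrow> 'a \<Rightarrow> 'a" where
  "wanas_operator br g nabla e1 e2 e3 X =
     (THE V. \<forall>Y. wanas_form br g nabla e1 e2 e3 X Y = g V Y)"

definition wanas_soliton_decomposition ::
    "('a::real_vector \<Rightarrow> 'a \<Rightarrow> 'a) \<Rightarrow> ('a \<Rightarrow> 'a \<Rightarrow> real) \<Rightarrow> ('a \<Rightarrow> 'a) \<Rightarrow>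
     'a \<Rightarrow> 'a \<Rightarrow> 'a \<Rightarrow> real \<Rightarrow> ('a \<Rightarrow> 'a) \<Rightarrow> bool" where
  "wanas_soliton_decomposition br g J e1 e2 e3 c D \<longleftrightarrow> lie_derivation br D \<and>
     (\<forall>X. wanas_operator br g (canonical_connection br g J) e1 e2 e3 X = c *\<^sub>R X + D X)"

definition first_kind_algebraic_wanas_soliton ::
    "('a::real_vector \<Rightarrow> 'a \<Rightarrow> 'a) \<Rightarrow> ('a \<Rightarrow> 'a \<Rightarrow> real) \<Rightarrow> ('a \<Rightarrow> 'a) \<Rightarrow>
     'a \<Rightarrow> 'a \<Rightarrow> 'a \<Rightarrow> real \<Rightarrow> bool" where
  "first_kind_algebraic_wanas_soliton br g J e1 e2 e3 c \<longleftrightarrow>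
     (\<exists>D. wanas_soliton_decomposition br g J e1 e2 e3 c D)"

text \<open>The definite descriptions above are well defined:\<close>

lemma pseudo_orthonormal_expand:
  assumes "pseudo_orthonormal_basis g e1 e2 e3" and "bilinear g"
  shows "X = g X e1 *\<^sub>R e1 + g X e2 *\<^sub>R e2 - g X e3 *\<^sub>R e3"
proof -
  have "X \<in> span {e1, e2, e3}"
    using assms by (simp add: pseudo_orthonormal_basis_def)
  then obtain a b c where X: "X = a *\<^sub>R e1 + b *\<^sub>R e2 + c *\<^sub>R e3"
    by (auto simp: span_insert span_empty algebra_simps)
  show ?thesis
    using assms(1) unfolding X
    by (simp add: pseudo_orthonormal_basis_def bilinear_ladd[OF assms(2)] bilinear_lmul[OF assms(2)])
qed

lemma lorentzian_metric3_riesz: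
  assumes "lorentzian_metric3 g" and "linear F"
  shows "\<exists>!V. \<forall>Y. F Y = g V Y"
proof -
  from assms(1) obtain e1 e2 e3 where e: "pseudo_orthonormal_basis g e1 e2 e3"
    and g: "bilinear g" and sym: "\<And>X Y. g X Y = g Y X"
    unfolding lorentzian_metric3_def by blast
  let ?V = "F e1 *\<^sub>R e1 + F e2 *\<^sub>R e2 - F e3 *\<^sub>R e3"
  have "F Y = g ?V Y" for Y
  proof -
    have "F Y = F (g Y e1 *\<^sub>R e1 + g Y e2 *\<^sub>R e2 - g Y e3 *\<^sub>R e3)"
      using pseudo_orthonormal_expand[OF e g, of Y] by simp
    also have "\<dots> = g ?V Y"
      by (simp add: linear_add[OF assms(2)] linear_diff[OF assms(2)] linear_cmul[OF assms(2)]
          bilinear_ladd[OF g] bilinear_lsub[OF g] bilinear_lmul[OF g] sym[of Y])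
    finally show ?thesis .
  qed
  moreover have "V = W" if "\<forall>Y. F Y = g V Y" "\<forall>Y. F Y = g W Y" for V W
    using pseudo_orthonormal_expand[OF e g, of V] pseudo_orthonormal_expand[OF e g, of W] that
    by metis
  ultimately show ?thesis by blast
qed

lemma is_levi_civita_ex1:
  assumes "lorentzian_metric3 g" and "lie_bracket br"
  shows "\<exists>!nabla. is_levi_civita br g nabla"
proof -
  from assms have g: "bilinear g" and sym: "\<And>X Y. g X Y = g Y X"
    and br: "bilinear br" and alt: "\<And>X. br X X = 0"
    unfolding lorentzian_metric3_def lie_bracket_def by blast+
  have skew: "br X Y = - br Y X" for X Y
  proof -
    have "br (X + Y) (X + Y) = br X X + br X Y + (br Y X + br Y Y)"
      by (simp only: bilinear_ladd[OF br] bilinear_radd[OF br]) (simp add: algebra_simps)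
    then have "br X Y + br Y X = 0" by (simp add: alt)
    then show ?thesis by (simp add: eq_neg_iff_add_eq_0)
  qed
  note lin = bilinear_ladd[OF g] bilinear_radd[OF g] bilinear_lmul[OF g] bilinear_rmul[OF g]
    bilinear_lsub[OF g] bilinear_lneg[OF g]
    bilinear_ladd[OF br] bilinear_radd[OF br] bilinear_lmul[OF br] bilinear_rmul[OF br]
  define K where "K X Y Z = (g (br X Y) Z - g (br Y Z) X + g (br Z X) Y) / 2" for X Y Z
  have linK: "linear (K X Y)" for X Y
    by (intro linearI) (simp_all add: K_def lin field_simps)
  have "\<forall>X Y. \<exists>V. \<forall>Z. K X Y Z = g V Z"
    using lorentzian_metric3_riesz[OF assms(1) linK] by blast
  then obtain N where N: "\<And>X Y Z. g (N X Y) Z = K X Y Z" by metis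
  have eqI: "V = W" if "\<And>Y. g V Y = g W Y" for V W
  proof -
    have "linear (g V)" using g by (simp add: bilinear_def)
    from lorentzian_metric3_riesz[OF assms(1) this] that show ?thesis by metis
  qed
  have "bilinear N"
    unfolding bilinear_def
    by (intro allI conjI linearI; rule eqI; simp add: N K_def lin; simp add: field_simps)
  moreover have "N X Y - N Y X = br X Y" for X Y
  proof (rule eqI)
    fix Z
    show "g (N X Y - N Y X) Z = g (br X Y) Z"
      using skew[of Y X] skew[of Z X] skew[of Z Y]
      by (simp add: N K_def lin field_simps)
  qed
  moreover have "g (N X Y) Z + g Y (N X Z) = 0" for X Y Z
    using skew[of Y X] skew[of Z X] skew[of Z Y]
    by (simp add: sym[of Y] N K_def lin field_simps)
  ultimately have ex: "is_levi_civita br g N" by (simp add: is_levi_civita_def)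
  moreover have "M = N" if M: "is_levi_civita br g M" for M
  proof (intro ext eqI)
    fix X Y Z
    from M have t: "\<And>X Y. br X Y = M X Y - M Y X"
      and m: "\<And>X Y Z. g (M X Y) Z = - g Y (M X Z)"
      by (simp_all add: is_levi_civita_def eq_neg_iff_add_eq_0)
    have "g (M X Y) Z = K X Y Z"
      unfolding K_def t lin
      using m[of X Y Z] m[of Y X Z] m[of Z X Y] sym[of Y "M X Z"] sym[of X "M Y Z"] sym[of X "M Z Y"] 
      by (simp add: field_simps)
    then show "g (M X Y) Z = g (N X Y) Z" by (simp add: N)
  qed
  ultimately show ?thesis by blast
qed

lemma wanas_operator_ex1:
  assumes "lorentzian_metric3 g" and "lie_bracket br" and "bilinear nabla"
  shows "\<exists>!V. \<forall>Y. wanas_form br g nabla e1 e2 e3 X Y = g V Y"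
proof (rule lorentzian_metric3_riesz[OF assms(1)])
  have g: "bilinear g" and br: "bilinear br"
    using assms unfolding lorentzian_metric3_def lie_bracket_def by blast+
  note lin = bilinear_ladd[OF g] bilinear_lmul[OF g] bilinear_lsub[OF g]
    bilinear_radd[OF br] bilinear_rmul[OF br]
    bilinear_ladd[OF assms(3)] bilinear_radd[OF assms(3)] bilinear_lmul[OF assms(3)] bilinear_rmul[OF assms(3)]
  show "linear (wanas_form br g nabla e1 e2 e3 X)"
    by (intro linearI)
      (simp_all add: wanas_form_def wanas_tensor_def curvature_def torsion_def lin algebra_simps)
qed

end

theory Submission
  imports Defs
begin

text \<open>
  The canonical connection is the part of the Levi-Civita connection that commutes with \<open>J\<close>.
  With \<open>R e\<^sub>1 = - e\<^sub>2\<close>, \<open>R e\<^sub>2 = e\<^sub>1\<close>, \<open>R e\<^sub>3 = 0\<close> it is \<open>\<nabla>\<^sup>0\<^sub>1 = 0\<close>, \<open>\<nabla>\<^sup>0\<^sub>2 = \<alpha> R\<close>,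
  \<open>\<nabla>\<^sup>0\<^sub>3 = - (\<beta> - \<gamma>) / 2 R\<close>, and the Wanas operator preserves the line of \<open>e\<^sub>1\<close> and the plane
  of \<open>e\<^sub>2, e\<^sub>3\<close>. Let \<open>M\<close> be \<open>ad e\<^sub>1\<close> on that plane. A block diagonal \<open>D\<close> with \<open>D e\<^sub>1 = d e\<^sub>1\<close>
  and block \<open>B\<close> is a derivation iff \<open>B M - M B = d M\<close>; taking traces gives \<open>d (\<alpha> + \<delta>) = 0\<close>.
  Hence \<open>d = 0\<close>, which determines \<open>c\<close>, and \<open>B\<close> commutes with \<open>M\<close>, which leaves only
  \<open>\<beta> = \<gamma> = 0\<close>. Case (iii) is void, since it contradicts \<open>\<alpha> + \<delta> \<noteq> 0\<close>.
\<close>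

lemma bilinear_skew:
  assumes "bilinear br" "\<And>X. br X X = 0"
  shows "br X Y = - br Y X"
proof -
  have "br (X + Y) (X + Y) = br X X + br X Y + (br Y X + br Y Y)"
    by (simp only: bilinear_ladd[OF assms(1)] bilinear_radd[OF assms(1)]) (simp add: algebra_simps)
  then show ?thesis
    by (simp add: assms(2) eq_neg_iff_add_eq_0)
qed

text \<open>The Koszul formula has no derivative terms here because metric coefficients of
  left-invariant fields are constant. It lets the connection, given only by a definite description,
  be computed from brackets.\<close>

lemma is_levi_civita_koszul:
  assumes "is_levi_civita br g nabla" and g: "bilinear g" and sym: "\<And>X Y. g X Y = g Y X"
  shows "g (nabla X Y) Z = (g (br X Y) Z - g (br Y Z) X + g (br Z X) Y) / 2"
proof -
  have t: "\<And>X Y. br X Y = nabla X Y - nabla Y X"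
    and m: "\<And>X Y Z. g (nabla X Y) Z = - g Y (nabla X Z)"
    using assms(1) by (simp_all add: is_levi_civita_def eq_neg_iff_add_eq_0)
  show ?thesis
    unfolding t bilinear_lsub[OF g]
    using m[of X Y Z] m[of Y X Z] m[of Z X Y]
      sym[of Y "nabla X Z"] sym[of X "nabla Y Z"] sym[of X "nabla Z Y"]
    by (simp add: field_simps)
qed

lemma bilinear_canonical_connection:
  assumes "bilinear (levi_civita br g)" "linear J"
  shows "bilinear (canonical_connection br g J)"
  unfolding bilinear_def canonical_connection_def cov_deriv_endo_def
  by (intro allI conjI linearI)
    (simp_all add: linear_add[OF assms(2)] linear_cmul[OF assms(2)] linear_diff[OF assms(2)]
      bilinear_ladd[OF assms(1)] bilinear_radd[OF assms(1)]
      bilinear_lmul[OF assms(1)] bilinear_rmul[OF assms(1)] algebra_simps)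

section \<open>Lorentzian Lie algebras of dimension three\<close>

locale lorentzian_lie_algebra3 =
  fixes br :: "'a::real_vector \<Rightarrow> 'a \<Rightarrow> 'a"
    and g :: "'a \<Rightarrow> 'a \<Rightarrow> real"
    and e1 e2 e3 :: 'a
  assumes lie: "lie_bracket br"
    and metric: "lorentzian_metric3 g"
    and basis: "pseudo_orthonormal_basis g e1 e2 e3"
begin

lemma bilinear_g: "bilinear g" and g_sym: "g X Y = g Y X"
  using metric unfolding lorentzian_metric3_def by blast+

lemma bilinear_br: "bilinear br" and br_self: "br X X = 0"
  using lie unfolding lie_bracket_def by blast+

lemma br_skew: "br X Y = - br Y X"
  by (rule bilinear_skew[OF bilinear_br br_self])

lemmas g_simps = bilinear_ladd[OF bilinear_g] bilinear_radd[OF bilinear_g]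
  bilinear_lmul[OF bilinear_g] bilinear_rmul[OF bilinear_g]
  bilinear_lsub[OF bilinear_g] bilinear_rsub[OF bilinear_g]
  bilinear_lneg[OF bilinear_g] bilinear_rneg[OF bilinear_g]
  bilinear_lzero[OF bilinear_g] bilinear_rzero[OF bilinear_g]

lemmas br_simps = bilinear_ladd[OF bilinear_br] bilinear_radd[OF bilinear_br]
  bilinear_lmul[OF bilinear_br] bilinear_rmul[OF bilinear_br]
  bilinear_lsub[OF bilinear_br] bilinear_rsub[OF bilinear_br]
  bilinear_lneg[OF bilinear_br] bilinear_rneg[OF bilinear_br]
  bilinear_lzero[OF bilinear_br] bilinear_rzero[OF bilinear_br]

lemma g_basis [simp]:
  "g e1 e1 = 1" "g e2 e2 = 1" "g e3 e3 = - 1"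
  "g e1 e2 = 0" "g e2 e1 = 0" "g e1 e3 = 0" "g e3 e1 = 0" "g e2 e3 = 0" "g e3 e2 = 0"
  using basis by (simp_all add: pseudo_orthonormal_basis_def)

lemmas expand = pseudo_orthonormal_expand[OF basis bilinear_g]

lemma eqI:
  assumes "g V e1 = g W e1" "g V e2 = g W e2" "g V e3 = g W e3"
  shows "V = W"
  using expand[of V] expand[of W] assms by simp

text \<open>The defect of the Leibniz rule is bilinear and alternating, so its values on three pairs
  of basis vectors determine it.\<close>

lemma lie_derivationI:
  assumes D: "linear D"
    and "D (br e1 e2) = br (D e1) e2 + br e1 (D e2)"
    and "D (br e1 e3) = br (D e1) e3 + br e1 (D e3)"
    and "D (br e2 e3) = br (D e2) e3 + br e2 (D e3)"
  shows "lie_derivation br D"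
  unfolding lie_derivation_def
proof (intro conjI allI D)
  fix X Y
  define F where "F X Y = D (br X Y) - (br (D X) Y + br X (D Y))" for X Y
  have F: "bilinear F"
    unfolding bilinear_def F_def
    by (intro allI conjI linearI)
      (simp_all add: linear_add[OF D] linear_cmul[OF D] br_simps algebra_simps)
  have alt: "F X X = 0" for X
    using br_skew[of "D X" X] by (simp add: F_def br_self linear_0[OF D])
  have F0: "F e1 e2 = 0" "F e1 e3 = 0" "F e2 e3 = 0"
    using assms by (simp_all add: F_def)
  moreover have "F e2 e1 = 0" "F e3 e1 = 0" "F e3 e2 = 0"
    using F0 bilinear_skew[OF F alt] by (metis neg_equal_0_iff_equal)+
  ultimately have "F (g X e1 *\<^sub>R e1 + g X e2 *\<^sub>R e2 - g X e3 *\<^sub>R e3)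
      (g Y e1 *\<^sub>R e1 + g Y e2 *\<^sub>R e2 - g Y e3 *\<^sub>R e3) = 0"
    by (simp add: alt bilinear_ladd[OF F] bilinear_radd[OF F] bilinear_lmul[OF F]
        bilinear_rmul[OF F] bilinear_lsub[OF F] bilinear_rsub[OF F])
  then have "F X Y = 0"
    using expand[of X] expand[of Y] by simp
  then show "D (br X Y) = br (D X) Y + br X (D Y)"
    by (simp add: F_def)
qed

lemma levi_civita: "is_levi_civita br g (levi_civita br g)"
  unfolding levi_civita_def by (rule theI'[OF is_levi_civita_ex1[OF metric lie]])

lemma bilinear_levi_civita: "bilinear (levi_civita br g)"
  using levi_civita by (simp add: is_levi_civita_def)

lemmas koszul = is_levi_civita_koszul[OF levi_civita bilinear_g g_sym]

lemma wanas_operator: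
  assumes "bilinear nabla"
  shows "g (wanas_operator br g nabla e1 e2 e3 X) Y = wanas_form br g nabla e1 e2 e3 X Y"
  using theI'[OF wanas_operator_ex1[OF metric lie assms]]
  unfolding wanas_operator_def by metis

text \<open>The operator is obtained by Riesz representation for each \<open>X\<close> separately;
  linearity in \<open>X\<close> passes from the form to the operator by nondegeneracy of
  \<open>g\<close>.\<close>

lemma linear_wanas_operator:
  assumes N: "bilinear nabla"
  shows "linear (wanas_operator br g nabla e1 e2 e3)"
proof -
  note lin = g_simps br_simps
    bilinear_ladd[OF N] bilinear_radd[OF N] bilinear_lmul[OF N] bilinear_rmul[OF N]
    bilinear_lsub[OF N] bilinear_rsub[OF N]
  have add: "wanas_form br g nabla e1 e2 e3 (X + X') Y =
      wanas_form br g nabla e1 e2 e3 X Y + wanas_form br g nabla e1 e2 e3 X' Y" for X X' Y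
    by (simp add: wanas_form_def wanas_tensor_def curvature_def torsion_def lin)
  have scale: "wanas_form br g nabla e1 e2 e3 (r *\<^sub>R X) Y =
      r * wanas_form br g nabla e1 e2 e3 X Y" for r X Y
    by (simp add: wanas_form_def wanas_tensor_def curvature_def torsion_def lin algebra_simps)
  show ?thesis
    by (intro linearI eqI) (simp_all add: wanas_operator[OF N] g_simps add scale)
qed

end

section \<open>Connection, torsion and Wanas operator of the algebra of \<open>G_6\<close>\<close>

locale g6_lie_algebra = lorentzian_lie_algebra3 br g e1 e2 e3
  for br :: "'a::real_vector \<Rightarrow> 'a \<Rightarrow> 'a"
    and g :: "'a \<Rightarrow> 'a \<Rightarrow> real"
    and e1 e2 e3 :: 'a +
  fixes J :: "'a \<Rightarrow> 'a"
    and \<alpha> \<beta> \<gamma> \<delta> :: real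
  assumes trace: "\<alpha> + \<delta> \<noteq> 0" and orth: "\<alpha> * \<gamma> - \<beta> * \<delta> = 0"
    and br12 [simp]: "br e1 e2 = \<alpha> *\<^sub>R e2 + \<beta> *\<^sub>R e3"
    and br13 [simp]: "br e1 e3 = \<gamma> *\<^sub>R e2 + \<delta> *\<^sub>R e3"
    and br23 [simp]: "br e2 e3 = 0"
    and linear_J: "linear J"
    and J_basis [simp]: "J e1 = e1" "J e2 = e2" "J e3 = - e3"
begin

abbreviation "canon \<equiv> canonical_connection br g J"
abbreviation "Wan \<equiv> wanas_operator br g canon e1 e2 e3"

lemmas J_simps = linear_add[OF linear_J] linear_diff[OF linear_J] linear_cmul[OF linear_J]
  linear_neg[OF linear_J] linear_0[OF linear_J]

lemma br_basis [simp]: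
  "br e2 e1 = - \<alpha> *\<^sub>R e2 - \<beta> *\<^sub>R e3" "br e3 e1 = - \<gamma> *\<^sub>R e2 - \<delta> *\<^sub>R e3" "br e3 e2 = 0"
  "br e1 e1 = 0" "br e2 e2 = 0" "br e3 e3 = 0"
  using br_skew[of e2 e1] br_skew[of e3 e1] br_skew[of e3 e2] by (simp_all add: br_self)

lemma levi_civita_basis:
  "levi_civita br g e1 e1 = 0"
  "levi_civita br g e1 e2 = ((\<beta> + \<gamma>) / 2) *\<^sub>R e3"
  "levi_civita br g e1 e3 = ((\<beta> + \<gamma>) / 2) *\<^sub>R e2"
  "levi_civita br g e2 e1 = - \<alpha> *\<^sub>R e2 - ((\<beta> - \<gamma>) / 2) *\<^sub>R e3"
  "levi_civita br g e2 e2 = \<alpha> *\<^sub>R e1"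
  "levi_civita br g e2 e3 = - ((\<beta> - \<gamma>) / 2) *\<^sub>R e1"
  "levi_civita br g e3 e1 = ((\<beta> - \<gamma>) / 2) *\<^sub>R e2 - \<delta> *\<^sub>R e3"
  "levi_civita br g e3 e2 = - ((\<beta> - \<gamma>) / 2) *\<^sub>R e1"
  "levi_civita br g e3 e3 = - \<delta> *\<^sub>R e1"
  by (rule eqI; simp add: koszul g_simps; simp add: field_simps)+

lemma bilinear_canonical: "bilinear canon"
  by (rule bilinear_canonical_connection[OF bilinear_levi_civita linear_J])

text \<open>Since \<open>J\<close> is an involution, the canonical connection sends
  \<open>X\<close>, \<open>Y\<close> to half the sum of \<open>nabla X Y\<close> and
  \<open>J (nabla X (J Y))\<close>. This deletes every term of the Levi-Civita table that mixes
  \<open>e3\<close> with the plane of \<open>e1\<close>, \<open>e2\<close>.\<close>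

lemma canonical_basis:
  "canon e1 e1 = 0" "canon e1 e2 = 0" "canon e1 e3 = 0"
  "canon e2 e1 = - \<alpha> *\<^sub>R e2" "canon e2 e2 = \<alpha> *\<^sub>R e1" "canon e2 e3 = 0"
  "canon e3 e1 = ((\<beta> - \<gamma>) / 2) *\<^sub>R e2" "canon e3 e2 = - ((\<beta> - \<gamma>) / 2) *\<^sub>R e1" "canon e3 e3 = 0"
  by (rule eqI; simp add: canonical_connection_def cov_deriv_endo_def levi_civita_basis
      bilinear_rneg[OF bilinear_levi_civita] J_simps g_simps; simp add: field_simps)+

lemmas canonical_simps =
  bilinear_ladd[OF bilinear_canonical] bilinear_radd[OF bilinear_canonical]
  bilinear_lmul[OF bilinear_canonical] bilinear_rmul[OF bilinear_canonical]
  bilinear_lsub[OF bilinear_canonical] bilinear_rsub[OF bilinear_canonical]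
  bilinear_lneg[OF bilinear_canonical] bilinear_rneg[OF bilinear_canonical]
  bilinear_lzero[OF bilinear_canonical] bilinear_rzero[OF bilinear_canonical]

lemma torsion_basis:
  "torsion br canon e1 e2 = - \<beta> *\<^sub>R e3"
  "torsion br canon e1 e3 = - ((\<beta> + \<gamma>) / 2) *\<^sub>R e2 - \<delta> *\<^sub>R e3"
  "torsion br canon e2 e3 = ((\<beta> - \<gamma>) / 2) *\<^sub>R e1"
  "torsion br canon e2 e1 = \<beta> *\<^sub>R e3"
  "torsion br canon e3 e1 = ((\<beta> + \<gamma>) / 2) *\<^sub>R e2 + \<delta> *\<^sub>R e3"
  "torsion br canon e3 e2 = - ((\<beta> - \<gamma>) / 2) *\<^sub>R e1"
  "torsion br canon X X = 0"
  by (rule eqI; simp add: torsion_def canonical_basis br_self g_simps; simp add: field_simps)+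

lemma bilinear_torsion: "bilinear (torsion br canon)"
  unfolding bilinear_def torsion_def
  by (intro allI conjI linearI) (simp_all add: canonical_simps br_simps algebra_simps)

lemmas torsion_simps =
  bilinear_ladd[OF bilinear_torsion] bilinear_lmul[OF bilinear_torsion]
  bilinear_lsub[OF bilinear_torsion] bilinear_lneg[OF bilinear_torsion]
  bilinear_lzero[OF bilinear_torsion]

text \<open>As \<open>e3\<close> is parallel for \<open>canon\<close>, curvature kills it, so the
  \<open>e3\<close> coefficients come from torsion alone. The form is not symmetric in general,
  hence the unrelated off-diagonal entries.\<close>

lemma Wan_basis:
  "Wan e1 = - (\<alpha>\<^sup>2 + \<delta>\<^sup>2 + \<beta> * (\<beta> + 3 * \<gamma>) / 2) *\<^sub>R e1"
  "Wan e2 = - (\<alpha>\<^sup>2 + \<beta> * (\<beta> - \<gamma>) / 2) *\<^sub>R e2 + (\<delta> * (\<beta> - \<gamma>) / 2) *\<^sub>R e3"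
  "Wan e3 = - (\<alpha> * \<gamma>) *\<^sub>R e2 - ((\<beta>\<^sup>2 - \<gamma>\<^sup>2) / 2) *\<^sub>R e3"
  by (rule eqI; simp add: wanas_operator[OF bilinear_canonical] wanas_form_def wanas_tensor_def
      curvature_def torsion_basis torsion_simps canonical_basis canonical_simps g_simps;
      simp add: field_simps power2_eq_square)+

section \<open>Soliton equations and their solutions\<close>

lemma soliton_parameters:
  assumes "wanas_soliton_decomposition br g J e1 e2 e3 c D"
  shows "\<beta> = 0" "\<gamma> = 0" "\<alpha>\<^sup>2 + \<delta>\<^sup>2 + c = 0"
proof -
  \<comment> \<open>These are entries of the matrix of \<open>D\<close>: \<open>d\<close> is its
    eigenvalue on \<open>e1\<close>, and \<open>bij\<close> is the \<open>ei\<close> coefficient of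
    \<open>D ej\<close>. The remaining entry of the block is -\<alpha>\<gamma>.\<close>
  define d b22 b32 b33 where
    "d = - (\<alpha>\<^sup>2 + \<delta>\<^sup>2 + \<beta> * (\<beta> + 3 * \<gamma>) / 2) - c"
    and "b22 = - (\<alpha>\<^sup>2 + \<beta> * (\<beta> - \<gamma>) / 2) - c"
    and "b32 = \<delta> * (\<beta> - \<gamma>) / 2"
    and "b33 = - ((\<beta>\<^sup>2 - \<gamma>\<^sup>2) / 2) - c"
  have lin: "linear D" and der: "\<And>X Y. D (br X Y) = br (D X) Y + br X (D Y)"
    and D: "\<And>X. D X = Wan X - c *\<^sub>R X"
    using assms by (simp_all add: wanas_soliton_decomposition_def lie_derivation_def)
  have D1: "D e1 = d *\<^sub>R e1" and D2: "D e2 = b22 *\<^sub>R e2 + b32 *\<^sub>R e3"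
    and D3: "D e3 = - (\<alpha> * \<gamma>) *\<^sub>R e2 + b33 *\<^sub>R e3"
    by (simp_all add: D Wan_basis d_def b22_def b32_def b33_def algebra_simps)
  note simps = D1 D2 D3 br_simps g_simps linear_add[OF lin] linear_cmul[OF lin]
  \<comment> \<open>Pairing with \<open>e2\<close> and \<open>e3\<close> extracts the four entries
    of the matrix identity B M = d M + M B; \<open>mij\<close> is the entry in row i and column
    j.\<close>
  have "g (D (br e1 e2)) e2 = g (br (D e1) e2 + br e1 (D e2)) e2"
    "g (D (br e1 e2)) e3 = g (br (D e1) e2 + br e1 (D e2)) e3"
    "g (D (br e1 e3)) e2 = g (br (D e1) e3 + br e1 (D e3)) e2"
    "g (D (br e1 e3)) e3 = g (br (D e1) e3 + br e1 (D e3)) e3"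
    by (simp_all only: der)
  then have m22: "- \<alpha> * \<gamma> * \<beta> = b32 * \<gamma> + d * \<alpha>"
    and m32: "\<alpha> * b32 + \<beta> * b33 = d * \<beta> + b22 * \<beta> + b32 * \<delta>"
    and m23: "\<gamma> * b22 - \<delta> * \<alpha> * \<gamma> = d * \<gamma> - \<alpha> * \<gamma> * \<alpha> + b33 * \<gamma>"
    and m33: "\<gamma> * b32 = d * \<delta> - \<alpha> * \<gamma> * \<beta>"
    by (simp_all add: simps algebra_simps)
  have "d * (\<alpha> + \<delta>) = 0"
    using m22 m33 by (simp add: algebra_simps)
  then have d: "d = 0" using trace by simp
  have "\<gamma> = 0"
  proof (rule ccontr)
    assume "\<gamma> \<noteq> 0"
    then have \<alpha>: "\<alpha> = \<beta> * \<delta> / \<gamma>" using orth by (simp add: field_simps)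
    have "\<delta> \<noteq> 0" using \<alpha> trace by auto
    have "\<gamma> * (b32 + \<alpha> * \<beta>) = 0" using m22 d by (simp add: algebra_simps)
    then have "b32 + \<alpha> * \<beta> = 0" using \<open>\<gamma> \<noteq> 0\<close> by simp
    \<comment> \<open>Substituting \<alpha> = \<beta>\<delta>/\<gamma> and clearing denominators
      turns the equation into a quadratic form in \<beta>, \<gamma> that splits into two linear
      factors.\<close>
    then have "\<delta> * ((2 * \<beta> - \<gamma>) * (\<beta> + \<gamma>)) = 0"
      using \<open>\<gamma> \<noteq> 0\<close> unfolding b32_def \<alpha> by (simp add: field_simps)
    then consider "\<gamma> = 2 * \<beta>" | "\<beta> = - \<gamma>" using \<open>\<delta> \<noteq> 0\<close> by fastforce
    then show False
    proof cases
      case 1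
      then have \<delta>: "\<delta> = 2 * \<alpha>" using \<alpha> \<open>\<gamma> \<noteq> 0\<close> by (simp add: field_simps)
      \<comment> \<open>On this branch the off-diagonal entry \<open>m23\<close> reduces to a
        vanishing sum of squares.\<close>
      have "\<gamma> * (b22 - b33 - \<delta> * \<alpha> + \<alpha> * \<alpha>) = 0" using m23 d by (simp add: algebra_simps)
      then have "b22 - b33 - \<delta> * \<alpha> + \<alpha> * \<alpha> = 0" using \<open>\<gamma> \<noteq> 0\<close> by simp
      then have "2 * \<alpha>\<^sup>2 + \<beta>\<^sup>2 = 0"
        unfolding b22_def b33_def \<delta> 1 by (simp add: field_simps power2_eq_square)
      then have "\<beta> = 0" by (smt (verit) zero_le_power2 zero_eq_power2)
      then show False using 1 \<open>\<gamma> \<noteq> 0\<close> by simp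
    next
      case 2
      \<comment> \<open>Here \<alpha> = -\<delta>, so the trace of \<open>ad e1\<close> would
        vanish.\<close>
      then show False using \<alpha> trace \<open>\<gamma> \<noteq> 0\<close> by simp
    qed
  qed
  moreover have "\<beta> = 0"
  proof (rule ccontr)
    assume "\<beta> \<noteq> 0"
    \<comment> \<open>Now \<open>ad e1\<close> has \<alpha> as its only diagonal entry, and
      \<open>m32\<close> forces \<alpha> = 0, again against the trace condition.\<close>
    then have "\<delta> = 0" using orth \<open>\<gamma> = 0\<close> by simp
    have "\<beta> * \<alpha>\<^sup>2 = 0"
      using m32 d \<open>\<gamma> = 0\<close> \<open>\<delta> = 0\<close>
      by (simp add: b22_def b32_def b33_def power2_eq_square algebra_simps)
    then show False using \<open>\<beta> \<noteq> 0\<close> \<open>\<delta> = 0\<close> trace by simp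
  qed
  ultimately show "\<beta> = 0" "\<gamma> = 0" "\<alpha>\<^sup>2 + \<delta>\<^sup>2 + c = 0"
    using d by (simp_all add: d_def)
qed

text \<open>Under these conditions both \<open>ad e1\<close> and the candidate derivation are
  diagonal in the basis, and the latter kills \<open>e1\<close>, so they commute.\<close>

lemma soliton_decomposition_exists:
  assumes "\<beta> = 0" "\<gamma> = 0" "\<alpha>\<^sup>2 + \<delta>\<^sup>2 + c = 0"
  shows "wanas_soliton_decomposition br g J e1 e2 e3 c (\<lambda>X. Wan X - c *\<^sub>R X)"
proof -
  have c: "c = - (\<alpha>\<^sup>2 + \<delta>\<^sup>2)" using assms(3) by simp
  note W = linear_wanas_operator[OF bilinear_canonical]
  note lin = linear_add[OF W] linear_cmul[OF W] linear_0[OF W]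
  have "linear (\<lambda>X. Wan X - c *\<^sub>R X)"
    by (intro linearI) (simp_all add: lin algebra_simps)
  then have "lie_derivation br (\<lambda>X. Wan X - c *\<^sub>R X)"
    by (rule lie_derivationI)
      (simp_all add: lin Wan_basis br_simps assms(1,2) c algebra_simps)
  then show ?thesis
    by (simp add: wanas_soliton_decomposition_def)
qed

lemma soliton_derivation:
  assumes "wanas_soliton_decomposition br g J e1 e2 e3 c D"
  shows "D e1 = 0" "D e2 = \<delta>\<^sup>2 *\<^sub>R e2" "D e3 = (\<alpha>\<^sup>2 + \<delta>\<^sup>2) *\<^sub>R e3"
proof -
  note p = soliton_parameters[OF assms]
  have c: "c = - (\<alpha>\<^sup>2 + \<delta>\<^sup>2)" using p(3) by simp
  have "D X = Wan X - c *\<^sub>R X" for X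
    using assms by (simp add: wanas_soliton_decomposition_def)
  then show "D e1 = 0" "D e2 = \<delta>\<^sup>2 *\<^sub>R e2" "D e3 = (\<alpha>\<^sup>2 + \<delta>\<^sup>2) *\<^sub>R e3"
    by (simp_all add: Wan_basis p(1,2) c algebra_simps)
qed

lemma soliton_iff:
  "first_kind_algebraic_wanas_soliton br g J e1 e2 e3 c \<longleftrightarrow>
    \<beta> = 0 \<and> \<gamma> = 0 \<and> \<alpha>\<^sup>2 + \<delta>\<^sup>2 + c = 0"
  using soliton_parameters soliton_decomposition_exists
  unfolding first_kind_algebraic_wanas_soliton_def by blast

end

theorem theorem3p6:
  fixes br :: "'a::real_vector \<Rightarrow> 'a \<Rightarrow> 'a"
    and g :: "'a \<Rightarrow> 'a \<Rightarrow> real"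
    and J :: "'a \<Rightarrow> 'a"
    and e1 e2 e3 :: 'a
    and \<alpha> \<beta> \<gamma> \<delta> c :: real
  assumes "\<alpha> + \<delta> \<noteq> 0" and "\<alpha> * \<gamma> - \<beta> * \<delta> = 0"
    and "lie_bracket br"
    and "lorentzian_metric3 g"
    and "pseudo_orthonormal_basis g e1 e2 e3"
    and "br e1 e2 = \<alpha> *\<^sub>R e2 + \<beta> *\<^sub>R e3"
    and "br e1 e3 = \<gamma> *\<^sub>R e2 + \<delta> *\<^sub>R e3"
    and "br e2 e3 = 0"
    and "linear J" and "J e1 = e1" and "J e2 = e2" and "J e3 = - e3"
  shows
    "(first_kind_algebraic_wanas_soliton br g J e1 e2 e3 c \<longleftrightarrow>
       (\<alpha> \<noteq> 0 \<and> \<beta> = 0 \<and> \<gamma> = 0 \<and> \<delta> = 0 \<and> \<alpha>^2 + c = 0) \<or>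
       (\<beta> = 0 \<and> \<gamma> = 0 \<and> \<alpha>^2 + \<delta>^2 + c = 0 \<and> \<delta> \<noteq> 0 \<and> \<alpha> + \<delta> \<noteq> 0) \<or>
       (\<beta> \<noteq> 0 \<and> \<delta> \<noteq> 0 \<and> \<gamma> = - \<beta> \<and> \<delta> = - \<alpha> \<and> \<alpha>^2 = \<beta>^2 \<and> \<alpha>^2 + c = 0)) \<and>
     (\<forall>D. wanas_soliton_decomposition br g J e1 e2 e3 c D \<longrightarrow>
       (\<alpha> \<noteq> 0 \<and> \<beta> = 0 \<and> \<gamma> = 0 \<and> \<delta> = 0 \<and> \<alpha>^2 + c = 0 \<longrightarrow>
          D e1 = 0 \<and> D e2 = 0 \<and> D e3 = \<alpha>^2 *\<^sub>R e3) \<and>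
       (\<beta> = 0 \<and> \<gamma> = 0 \<and> \<alpha>^2 + \<delta>^2 + c = 0 \<and> \<delta> \<noteq> 0 \<and> \<alpha> + \<delta> \<noteq> 0 \<longrightarrow>
          D e1 = 0 \<and> D e2 = \<delta>^2 *\<^sub>R e2 \<and> D e3 = (\<alpha>^2 + \<delta>^2) *\<^sub>R e3) \<and>
       (\<beta> \<noteq> 0 \<and> \<delta> \<noteq> 0 \<and> \<gamma> = - \<beta> \<and> \<delta> = - \<alpha> \<and> \<alpha>^2 = \<beta>^2 \<and> \<alpha>^2 + c = 0 \<longrightarrow>
          D e1 = 0 \<and> D e2 = - (\<beta>^2) *\<^sub>R e2 - (\<alpha> * \<beta>) *\<^sub>R e3 \<and>
          D e3 = (\<alpha> * \<beta>) *\<^sub>R e2 + \<alpha>^2 *\<^sub>R e3))"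
proof -
  interpret g6_lie_algebra br g e1 e2 e3 J \<alpha> \<beta> \<gamma> \<delta>
    using assms by (intro g6_lie_algebra.intro lorentzian_lie_algebra3.intro g6_lie_algebra_axioms.intro)
  show ?thesis
    \<comment> \<open>Cases (i) and (ii) split the solution set according to whether \<delta>
      vanishes; if it does, the trace condition gives \<alpha> \<noteq> 0.\<close>
    unfolding soliton_iff using trace by (auto simp: soliton_derivation)
qed

end
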